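(* Let $k \ge 0$ be an integer and let $G$ be a graph on $n$ vertices with average degree ${\rm d}$. Then: (i) $\displaystyle \varphi_k(G) \ge \sum_{v \in V(G)} \frac{1}{n-\deg(v)+k} \ge \frac{n}{n - {\rm d} + k}$; (ii) $\displaystyle \Omega_k(G) \ge \sum_{v \in V(G)} \frac{1}{\deg(v)+k+1} \ge \frac{n}{{\rm d} + k + 1}$.
   Context: Graphs are finite and simple with nonempty vertex set; $n = |V(G)|$ and ${\rm d} = \frac{1}{n}\sum_{v \in V(G)} \deg(v)$. For an integer $k \ge 0$: a set $A \subseteq V(G)$ is $k$-small if $\deg(v) \le n - |A| + k$ for every $v \in A$; a set $B \subseteq V(G)$ is $k$-large if $\deg(v) \ge |B| - k - 1$ for every $v \in B$. $\varphi_k(G)$ (resp. $\Omega_k(G)$) is the minimum integer $t$ such that $V(G)$ can be partitioned into $t$ $k$-small (resp. $k$-large) sets. *)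

theory Defs
  imports Complex_Main "HOL-Library.Disjoint_Sets" "Graph_Theory.Digraph"
begin

(* A finite simple graph is an instance of the locale graph of Graph_Theory: a finite, loop-free
   digraph without parallel arcs whose arc relation is symmetric.  An undirected edge uv is the
   pair of opposite arcs (u,v), (v,u), so the number of neighbours of v is its out-degree.
   The locale admits the null graph, hence non-emptiness must be assumed separately. *)

abbreviation deg :: "('a, 'b) pre_digraph \<Rightarrow> 'a \<Rightarrow> nat" where
  "deg G v \<equiv> out_degree G v"

definition avg_degree :: "('a, 'b) pre_digraph \<Rightarrow> real" where
  "avg_degree G = (\<Sum>v\<in>verts G. real (deg G v)) / real (card (verts G))"

(* Stated over int, so that subtraction does not truncate. *)

definition k_small :: "nat \<Rightarrow> ('a, 'b) pre_digraph \<Rightarrow> 'a set \<Rightarrow> bool" where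
  "k_small k G A \<longleftrightarrow> A \<subseteq> verts G \<and>
     (\<forall>v\<in>A. int (deg G v) \<le> int (card (verts G)) - int (card A) + int k)"

definition k_large :: "nat \<Rightarrow> ('a, 'b) pre_digraph \<Rightarrow> 'a set \<Rightarrow> bool" where
  "k_large k G B \<longleftrightarrow> B \<subseteq> verts G \<and>
     (\<forall>v\<in>B. int (deg G v) \<ge> int (card B) - int k - 1)"

definition small_partition_number :: "nat \<Rightarrow> ('a, 'b) pre_digraph \<Rightarrow> nat" where
  "small_partition_number k G =
     (LEAST t. \<exists>P. partition_on (verts G) P \<and> card P = t \<and> (\<forall>A\<in>P. k_small k G A))"

definition large_partition_number :: "nat \<Rightarrow> ('a, 'b) pre_digraph \<Rightarrow> nat" where
  "large_partition_number k G =
     (LEAST t. \<exists>P. partition_on (verts G) P \<and> card P = t \<and> (\<forall>B\<in>P. k_large k G B))"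

(* The singletons form admissible partitions, so both minima above range over non-empty sets. *)

lemma deg_less_card_verts:
  assumes "graph G" "v \<in> verts G"
  shows "deg G v < card (verts G)"
proof -
  interpret graph G by fact
  have inj: "inj_on (head G) (out_arcs G v)"
    by (rule inj_onI, rule no_multi_arcs) (auto simp: arc_to_ends_def)
  have sub: "head G ` out_arcs G v \<subseteq> verts G - {v}"
    using no_loops by fastforce
  have "deg G v = card (head G ` out_arcs G v)"
    by (simp add: out_degree_def card_image[OF inj])
  also have "\<dots> \<le> card (verts G - {v})"
    by (rule card_mono[OF _ sub]) simp
  also have "\<dots> < card (verts G)"
    by (rule card_Diff1_less) (use assms in auto)
  finally show ?thesis .
qed

lemma partition_on_singletons: "partition_on V ((\<lambda>v. {v}) ` V)"
  by (rule partition_onI) (auto simp: disjnt_def)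

lemma small_partition_exists:
  assumes "graph G"
  shows "\<exists>P. partition_on (verts G) P \<and> (\<forall>A\<in>P. k_small k G A)"
  by (rule exI[of _ "(\<lambda>v. {v}) ` verts G"])
     (use deg_less_card_verts[OF assms] in \<open>fastforce simp: partition_on_singletons k_small_def\<close>)

lemma large_partition_exists:
  "\<exists>P. partition_on (verts G) P \<and> (\<forall>B\<in>P. k_large k G B)"
  by (rule exI[of _ "(\<lambda>v. {v}) ` verts G"])
     (auto simp: partition_on_singletons k_large_def)

end

theory Submission
  imports Defs
begin

text \<open>
  If every vertex v of each part A of a partition satisfies |A| \<le> f v, then the reciprocals 1 / f v
  sum to at most 1 over each part, hence to at most the number of parts over all vertices. The two
  notions of admissible part are exactly this condition, for f v = n - deg v + k and for
  f v = deg v + k + 1. The second inequalities are those between harmonic and arithmetic mean.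
\<close>

lemma sum_inverse_le_card_partition:
  fixes f :: "'a \<Rightarrow> real"
  assumes "finite V" "partition_on V P"
    and le: "\<And>A v. A \<in> P \<Longrightarrow> v \<in> A \<Longrightarrow> real (card A) \<le> f v"
  shows "(\<Sum>v\<in>V. 1 / f v) \<le> real (card P)"
proof -
  have fin: "finite A" and ne: "A \<noteq> {}" if "A \<in> P" for A
    using that assms(1,2) by (auto simp: partition_on_def intro: finite_subset)
  have part: "(\<Sum>v\<in>A. 1 / f v) \<le> 1" if "A \<in> P" for A
  proof -
    have pos: "0 < real (card A)"
      using fin[OF that] ne[OF that] by (simp add: card_gt_0_iff)
    \<comment> \<open>From 0 < |A| \<le> f v, every f v on A is positive, so each reciprocal is at
      most 1 / |A|, and there are |A| of them.\<close>
    have "(\<Sum>v\<in>A. 1 / f v) \<le> (\<Sum>v\<in>A. 1 / real (card A))"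
      by (intro sum_mono divide_left_mono le[OF that] mult_pos_pos pos)
         (use pos le[OF that] in \<open>force+\<close>)
    also have "\<dots> = 1"
      using pos by simp
    finally show ?thesis .
  qed
  have "(\<Sum>v\<in>V. 1 / f v) = (\<Sum>A\<in>P. \<Sum>v\<in>A. 1 / f v)"
    using assms(2) fin sum.Union_disjoint[of P "\<lambda>v. 1 / f v"]
    by (auto simp: partition_on_def disjoint_def)
  also have "\<dots> \<le> (\<Sum>A\<in>P. 1)"
    by (rule sum_mono) (rule part)
  finally show ?thesis
    by simp
qed

text \<open>Convexity of 1 / x on the positive reals: the curve lies above its tangent at the mean
  of f, and in the sum over V the deviations from the mean cancel.\<close>

lemma card_div_mean_le_sum_inverse:
  fixes f :: "'a \<Rightarrow> real"
  assumes "finite V" "V \<noteq> {}" and pos: "\<And>v. v \<in> V \<Longrightarrow> 0 < f v"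
  shows "real (card V) / ((\<Sum>v\<in>V. f v) / real (card V)) \<le> (\<Sum>v\<in>V. 1 / f v)"
proof -
  define m where "m = (\<Sum>v\<in>V. f v) / real (card V)"
  have card: "0 < real (card V)"
    using assms(1,2) by (simp add: card_gt_0_iff)
  have m: "0 < m"
    unfolding m_def using assms card by (intro divide_pos_pos sum_pos) auto
  \<comment> \<open>the tangent line of 1 / x at the mean m\<close>
  have tangent: "2 / m - x / m\<^sup>2 \<le> 1 / x" if "0 < x" for x
  proof -
    have "1 / x - (2 / m - x / m\<^sup>2) = (x - m)\<^sup>2 / (x * m\<^sup>2)"
      using that m by (simp add: field_simps power2_eq_square)
    also have "\<dots> \<ge> 0"
      using that by simp
    finally show ?thesis
      by simp
  qed
  \<comment> \<open>Since the values of f add up to m |V|, the subtracted term is |V| / m, half of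
    the first term.\<close>
  have "real (card V) / m = real (card V) * (2 / m) - (\<Sum>v\<in>V. f v) / m\<^sup>2"
    using card m by (simp add: m_def field_simps power2_eq_square)
  also have "\<dots> = (\<Sum>v\<in>V. 2 / m - f v / m\<^sup>2)"
    by (simp add: sum_subtractf sum_divide_distrib)
  also have "\<dots> \<le> (\<Sum>v\<in>V. 1 / f v)"
    by (intro sum_mono tangent pos)
  finally show ?thesis
    by (simp add: m_def)
qed

text \<open>Replaces the \<open>LEAST\<close> by an optimal partition, to which the bound on sums of
  reciprocals applies. \<open>graph G\<close> enters through deg v < n, which makes singletons
  k-small.\<close>

lemma small_partition_number_witness:
  assumes "graph G"
  obtains P where "partition_on (verts G) P" "card P = small_partition_number k G"
    "\<And>A. A \<in> P \<Longrightarrow> k_small k G A"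
proof -
  have "\<exists>P. partition_on (verts G) P \<and> card P = small_partition_number k G \<and> (\<forall>A\<in>P. k_small k G A)"
    unfolding small_partition_number_def
    by (rule LeastI_ex) (use small_partition_exists[OF assms] in blast)
  with that show thesis
    by blast
qed

lemma large_partition_number_witness:
  obtains P where "partition_on (verts G) P" "card P = large_partition_number k G"
    "\<And>B. B \<in> P \<Longrightarrow> k_large k G B"
proof -
  have "\<exists>P. partition_on (verts G) P \<and> card P = large_partition_number k G \<and> (\<forall>B\<in>P. k_large k G B)"
    unfolding large_partition_number_def
    by (rule LeastI_ex) (use large_partition_exists in blast)
  with that show thesis
    by blast
qed

theorem theorem4p1:
  fixes G :: "('a, 'b) pre_digraph" and k n :: nat and d :: real
  assumes "graph G" and "verts G \<noteq> {}"
    and "n = card (verts G)" and "d = avg_degree G"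
  shows "(real (small_partition_number k G)
            \<ge> (\<Sum>v\<in>verts G. 1 / (real n - real (deg G v) + real k))
          \<and> (\<Sum>v\<in>verts G. 1 / (real n - real (deg G v) + real k))
            \<ge> real n / (real n - d + real k))
       \<and> (real (large_partition_number k G)
            \<ge> (\<Sum>v\<in>verts G. 1 / (real (deg G v) + real k + 1))
          \<and> (\<Sum>v\<in>verts G. 1 / (real (deg G v) + real k + 1))
            \<ge> real n / (d + real k + 1))"
proof -
  interpret graph G by fact
  have card: "0 < real n"
    using assms(2,3) by (simp add: card_gt_0_iff)
  have sum_deg: "(\<Sum>v\<in>verts G. real (deg G v)) = d * real n"
    using card assms(3,4) by (simp add: avg_degree_def)
  \<comment> \<open>Strictness keeps n - deg v + k positive even for k = 0.\<close>
  have deg_less: "deg G v < n" if "v \<in> verts G" for v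
    using deg_less_card_verts[OF assms(1) that] assms(3) by simp
  obtain P where P: "partition_on (verts G) P" "card P = small_partition_number k G"
    "\<And>A. A \<in> P \<Longrightarrow> k_small k G A"
    by (rule small_partition_number_witness[OF assms(1), where k = k]) blast
  obtain Q where Q: "partition_on (verts G) Q" "card Q = large_partition_number k G"
    "\<And>B. B \<in> Q \<Longrightarrow> k_large k G B"
    by (rule large_partition_number_witness[where k = k and G = G]) blast
  \<comment> \<open>Being k-small, solved for |A|, reads |A| \<le> n - deg v + k for all v in A; the
    integer inequality carries over to the reals.\<close>
  have "(\<Sum>v\<in>verts G. 1 / (real n - real (deg G v) + real k)) \<le> real (small_partition_number k G)"
    using P(3) unfolding P(2)[symmetric] assms(3)
    by (intro sum_inverse_le_card_partition finite_verts P(1)) (fastforce simp: k_small_def)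
  \<comment> \<open>Likewise, being k-large amounts to |B| \<le> deg v + k + 1 for all v in
    B.\<close>
  moreover have "(\<Sum>v\<in>verts G. 1 / (real (deg G v) + real k + 1)) \<le> real (large_partition_number k G)"
    using Q(3) unfolding Q(2)[symmetric]
    by (intro sum_inverse_le_card_partition finite_verts Q(1)) (fastforce simp: k_large_def)
  moreover have "real n / (real n - d + real k)
      \<le> (\<Sum>v\<in>verts G. 1 / (real n - real (deg G v) + real k))"
  proof -
    \<comment> \<open>The denominators are affine in the degree, so their mean is the same
      expression at the average degree d.\<close>
    have "(\<Sum>v\<in>verts G. real n - real (deg G v) + real k) / real n = real n - d + real k"
      using card by (simp add: sum.distrib sum_subtractf sum_deg flip: assms(3)) (simp add: field_simps)
    moreover have "real n / ((\<Sum>v\<in>verts G. real n - real (deg G v) + real k) / real n)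
        \<le> (\<Sum>v\<in>verts G. 1 / (real n - real (deg G v) + real k))"
      unfolding assms(3) using assms(2) deg_less[unfolded assms(3)]
      by (intro card_div_mean_le_sum_inverse) (auto intro: add_pos_nonneg)
    ultimately show ?thesis
      by simp
  qed
  moreover have "real n / (d + real k + 1) \<le> (\<Sum>v\<in>verts G. 1 / (real (deg G v) + real k + 1))"
  proof -
    have "(\<Sum>v\<in>verts G. real (deg G v) + real k + 1) / real n = d + real k + 1"
      using card by (simp add: sum.distrib sum_deg flip: assms(3)) (simp add: field_simps)
    \<comment> \<open>The summand 1 makes the denominators positive, also at isolated vertices when
      k = 0.\<close>
    moreover have "real n / ((\<Sum>v\<in>verts G. real (deg G v) + real k + 1) / real n)
        \<le> (\<Sum>v\<in>verts G. 1 / (real (deg G v) + real k + 1))"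
      unfolding assms(3) using assms(2)
      by (intro card_div_mean_le_sum_inverse) (auto intro: add_nonneg_pos)
    ultimately show ?thesis
      by simp
  qed
  ultimately show ?thesis
    by simp
qed

end
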